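(* Let $\sigma$ be an endomorphism of a ring $R$. If $R[x;\sigma]$ is a semicommutative ring, then $R$ is $\sigma$-skew McCoy.
   Context: All rings are associative with identity. $R[x;\sigma]$ is the skew polynomial ring: polynomials in $x$ with coefficients from $R$ written on the left, with $xa=\sigma(a)x$ for $a\in R$. A ring $T$ is semicommutative if for all $a,b\in T$, $ab=0$ implies $aTb=0$. $R$ is $\sigma$-skew McCoy if for any nonzero polynomials $p(x),q(x)\in R[x;\sigma]$, $p(x)q(x)=0$ implies $p(x)c=0$ for some nonzero $c\in R$ (products taken in $R[x;\sigma]$). *)

theory Defs
  imports "HOL-Algebra.UnivPoly"
begin

text \<open>
  The skew polynomial ring \<open>R[x;\<sigma>]\<close> with coefficients on the left: it has the elements, the
  addition, the unit and the monomials of \<^term>\<open>UP R\<close>. Distributing and moving powers of \<open>x\<close> to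
  the right by \<open>x a = \<sigma>(a) x\<close> gives \<open>(a x\<^sup>i) (b x\<^sup>j) = a \<sigma>\<^sup>i(b) x\<^sup>i\<^sup>+\<^sup>j\<close>, hence the formula for
  the product.
\<close>

definition skew_UP :: "('a, 'm) ring_scheme \<Rightarrow> ('a \<Rightarrow> 'a) \<Rightarrow> ('a, nat \<Rightarrow> 'a) up_ring"
  where "skew_UP R \<sigma> = (UP R)
    \<lparr>mult := (\<lambda>p\<in>up R. \<lambda>q\<in>up R. \<lambda>n. \<Oplus>\<^bsub>R\<^esub>i \<in> {..n}. p i \<otimes>\<^bsub>R\<^esub> (\<sigma> ^^ i) (q (n - i)))\<rparr>"

definition semicommutative :: "('a, 'm) ring_scheme \<Rightarrow> bool"
  where "semicommutative T \<longleftrightarrow>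
    (\<forall>a \<in> carrier T. \<forall>b \<in> carrier T. a \<otimes>\<^bsub>T\<^esub> b = \<zero>\<^bsub>T\<^esub> \<longrightarrow>
      (\<forall>t \<in> carrier T. a \<otimes>\<^bsub>T\<^esub> t \<otimes>\<^bsub>T\<^esub> b = \<zero>\<^bsub>T\<^esub>))"

text \<open>
  The element \<open>c\<close> of \<open>R\<close> is embedded in \<open>R[x;\<sigma>]\<close> as the constant polynomial
  \<open>monom (skew_UP R \<sigma>) c 0\<close>; the product is the skew one, so \<open>p(x) c\<close> is not coefficientwise
  right multiplication by \<open>c\<close>.
\<close>

definition skew_McCoy :: "('a, 'm) ring_scheme \<Rightarrow> ('a \<Rightarrow> 'a) \<Rightarrow> bool"
  where "skew_McCoy R \<sigma> \<longleftrightarrow>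
    (\<forall>p \<in> carrier (skew_UP R \<sigma>). \<forall>q \<in> carrier (skew_UP R \<sigma>).
      p \<noteq> \<zero>\<^bsub>skew_UP R \<sigma>\<^esub> \<longrightarrow> q \<noteq> \<zero>\<^bsub>skew_UP R \<sigma>\<^esub> \<longrightarrow>
      p \<otimes>\<^bsub>skew_UP R \<sigma>\<^esub> q = \<zero>\<^bsub>skew_UP R \<sigma>\<^esub> \<longrightarrow>
      (\<exists>c \<in> carrier R. c \<noteq> \<zero>\<^bsub>R\<^esub> \<and>
        p \<otimes>\<^bsub>skew_UP R \<sigma>\<^esub> monom (skew_UP R \<sigma>) c 0 = \<zero>\<^bsub>skew_UP R \<sigma>\<^esub>))"

lemma skew_UP_simps:
  "carrier (skew_UP R \<sigma>) = up R"
  "\<zero>\<^bsub>skew_UP R \<sigma>\<^esub> = (\<lambda>i. \<zero>\<^bsub>R\<^esub>)"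
  "\<one>\<^bsub>skew_UP R \<sigma>\<^esub> = (\<lambda>i. if i = 0 then \<one>\<^bsub>R\<^esub> else \<zero>\<^bsub>R\<^esub>)"
  "p \<in> up R \<Longrightarrow> q \<in> up R \<Longrightarrow> p \<oplus>\<^bsub>skew_UP R \<sigma>\<^esub> q = (\<lambda>i. p i \<oplus>\<^bsub>R\<^esub> q i)"
  "p \<in> up R \<Longrightarrow> q \<in> up R \<Longrightarrow> p \<otimes>\<^bsub>skew_UP R \<sigma>\<^esub> q =
    (\<lambda>n. \<Oplus>\<^bsub>R\<^esub>i \<in> {..n}. p i \<otimes>\<^bsub>R\<^esub> (\<sigma> ^^ i) (q (n - i)))"
  "a \<in> carrier R \<Longrightarrow> monom (skew_UP R \<sigma>) a n = (\<lambda>i. if i = n then a else \<zero>\<^bsub>R\<^esub>)"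
  by (simp_all add: skew_UP_def UP_def)

context ring
begin

lemma endo_funpow:
  assumes "\<sigma> \<in> ring_hom R R"
  shows "\<sigma> ^^ n \<in> ring_hom R R"
proof (induction n)
  case 0
  show ?case by (rule ring_hom_memI) auto
next
  case (Suc n)
  from ring_hom_trans[OF this assms] show ?case by (simp only: funpow.simps)
qed

lemma endo_finsum:
  assumes h: "h \<in> ring_hom R R" and f: "\<And>i. f i \<in> carrier R" and A: "finite A"
  shows "h (finsum R f A) = (\<Oplus>i \<in> A. h (f i))"
proof -
  interpret H: ring_hom_ring R R h
    by (rule ring_hom_ringI2) (use h ring_axioms in auto)
  show ?thesis using H.hom_finsum[of f A] f by (simp add: o_def Pi_def)
qed

lemma up_monom_closed: "a \<in> carrier R \<Longrightarrow> (\<lambda>i. if i = n then a else \<zero>) \<in> up R"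
  by (force simp: up_def)

lemma up_skew_mult_closed:
  assumes s: "\<sigma> \<in> ring_hom R R" and p: "p \<in> up R" and q: "q \<in> up R"
  shows "(\<lambda>n. \<Oplus>i \<in> {..n}. p i \<otimes> (\<sigma> ^^ i) (q (n - i))) \<in> up R"
proof
  note cl = ring_hom_closed[OF endo_funpow[OF s]]
  show "(\<Oplus>i \<in> {..n}. p i \<otimes> (\<sigma> ^^ i) (q (n - i))) \<in> carrier R" for n
    by (intro finsum_closed Pi_I m_closed cl mem_upD[OF p] mem_upD[OF q])
  from p q obtain n m where n: "bound \<zero> n p" and m: "bound \<zero> m q" by fast
  have "(\<Oplus>i \<in> {..k}. p i \<otimes> (\<sigma> ^^ i) (q (k - i))) = \<zero>" if "n + m < k" for k
  proof -
    have "p i \<otimes> (\<sigma> ^^ i) (q (k - i)) = \<zero>" for i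
    proof (cases "n < i")
      case True
      then have "p i = \<zero>" using n by auto
      then show ?thesis by (simp add: l_null[OF cl[OF mem_upD[OF q]]])
    next
      case False
      with that have "m < k - i" by arith
      then have "q (k - i) = \<zero>" using m by auto
      then show ?thesis
        using ring_hom_zero[OF endo_funpow[OF s] ring_axioms ring_axioms]
          r_null[OF mem_upD[OF p]] by simp
    qed
    then show ?thesis by simp
  qed
  then show "\<exists>k. bound \<zero> k (\<lambda>n. \<Oplus>i \<in> {..n}. p i \<otimes> (\<sigma> ^^ i) (q (n - i)))"
    by blast
qed

lemma skew_assoc_aux:
  assumes s: "\<sigma> \<in> ring_hom R R"
    and a: "\<And>i. a i \<in> carrier R" and b: "\<And>i. b i \<in> carrier R" and c: "\<And>i. c i \<in> carrier R"
    and kn: "k \<le> n"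
  shows "(\<Oplus>j \<in> {..k}. (\<Oplus>i \<in> {..j}. a i \<otimes> (\<sigma> ^^ i) (b (j - i))) \<otimes> (\<sigma> ^^ j) (c (n - j))) =
    (\<Oplus>j \<in> {..k}. a j \<otimes> (\<Oplus>i \<in> {..k - j}. (\<sigma> ^^ j) (b i \<otimes> (\<sigma> ^^ i) (c (n - j - i)))))"
  using kn
proof (induction k)
  case 0
  then show ?case by (simp add: Pi_def m_assoc a b c)
next
  case (Suc k)
  note cl [simp] = ring_hom_closed[OF endo_funpow[OF s]]
  have mult: "(\<sigma> ^^ j) (x \<otimes> y) = (\<sigma> ^^ j) x \<otimes> (\<sigma> ^^ j) y"
    if "x \<in> carrier R" "y \<in> carrier R" for j x y
    using ring_hom_mult[OF endo_funpow[OF s] that] .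
  define F where "F j i = a j \<otimes> ((\<sigma> ^^ j) (b i) \<otimes> (\<sigma> ^^ (j + i)) (c (n - j - i)))" for j i
  have F: "F j i \<in> carrier R" for j i by (simp add: F_def a b c)
  have L: "(\<Oplus>i \<in> {..Suc k}. a i \<otimes> (\<sigma> ^^ i) (b (Suc k - i))) \<otimes> (\<sigma> ^^ Suc k) (c (n - Suc k))
      = (\<Oplus>j \<in> {..Suc k}. F j (Suc k - j))"
  proof -
    have "(\<Oplus>i \<in> {..Suc k}. a i \<otimes> (\<sigma> ^^ i) (b (Suc k - i))) \<otimes> (\<sigma> ^^ Suc k) (c (n - Suc k))
      = (\<Oplus>i \<in> {..Suc k}. a i \<otimes> (\<sigma> ^^ i) (b (Suc k - i)) \<otimes> (\<sigma> ^^ Suc k) (c (n - Suc k)))"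
      by (rule finsum_ldistr) (simp_all add: a b c Pi_def del: funpow.simps)
    also have "\<dots> = (\<Oplus>j \<in> {..Suc k}. F j (Suc k - j))"
      by (rule finsum_cong')
        (auto simp add: F_def a b c m_assoc Pi_def simp del: funpow.simps)
    finally show ?thesis .
  qed
  have Rr: "a j \<otimes> (\<Oplus>i \<in> {..l}. (\<sigma> ^^ j) (b i \<otimes> (\<sigma> ^^ i) (c (n - j - i)))) = (\<Oplus>i \<in> {..l}. F j i)"
    for j l
  proof -
    have "a j \<otimes> (\<Oplus>i \<in> {..l}. (\<sigma> ^^ j) (b i \<otimes> (\<sigma> ^^ i) (c (n - j - i))))
      = (\<Oplus>i \<in> {..l}. a j \<otimes> (\<sigma> ^^ j) (b i \<otimes> (\<sigma> ^^ i) (c (n - j - i))))"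
      by (rule finsum_rdistr) (simp_all add: a b c Pi_def)
    also have "\<dots> = (\<Oplus>i \<in> {..l}. F j i)"
      by (rule finsum_cong') (auto simp add: F_def a b c mult funpow_add)
    finally show ?thesis .
  qed
  have S: "(\<Oplus>j \<in> {..k}. \<Oplus>i \<in> {..Suc k - j}. F j i)
      = (\<Oplus>j \<in> {..k}. (\<Oplus>i \<in> {..k - j}. F j i) \<oplus> F j (Suc k - j))"
  proof (rule finsum_cong')
    fix j assume "j \<in> {..k}"
    then have "Suc k - j = Suc (k - j)" by auto
    then show "(\<Oplus>i \<in> {..Suc k - j}. F j i) = (\<Oplus>i \<in> {..k - j}. F j i) \<oplus> F j (Suc k - j)"
      by (simp add: F a_comm Pi_def)
  qed (simp_all add: F Pi_def)
  let ?l = "\<lambda>j. (\<Oplus>i \<in> {..j}. a i \<otimes> (\<sigma> ^^ i) (b (j - i))) \<otimes> (\<sigma> ^^ j) (c (n - j))"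
  have lc: "?l j \<in> carrier R" for j
    by (intro m_closed finsum_closed) (simp_all add: a b c Pi_def)
  have "(\<Oplus>j \<in> {..Suc k}. ?l j) = ?l (Suc k) \<oplus> (\<Oplus>j \<in> {..k}. ?l j)"
    by (rule finsum_Suc) (use lc in blast)
  also have "(\<Oplus>j \<in> {..k}. ?l j) = (\<Oplus>j \<in> {..k}. \<Oplus>i \<in> {..k - j}. F j i)"
    using Suc by (simp only: Rr Suc_leD)
  also have "?l (Suc k) = F (Suc k) 0 \<oplus> (\<Oplus>j \<in> {..k}. F j (Suc k - j))"
    unfolding L by (simp add: F Pi_def)
  also have "F (Suc k) 0 \<oplus> (\<Oplus>j \<in> {..k}. F j (Suc k - j)) \<oplus> (\<Oplus>j \<in> {..k}. \<Oplus>i \<in> {..k - j}. F j i)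
      = F (Suc k) 0 \<oplus> (\<Oplus>j \<in> {..k}. (\<Oplus>i \<in> {..k - j}. F j i) \<oplus> F j (Suc k - j))"
    by (subst finsum_addf) (simp_all add: F Pi_def a_ac)
  also have "\<dots> = (\<Oplus>j \<in> {..Suc k}. \<Oplus>i \<in> {..Suc k - j}. F j i)"
    unfolding S[symmetric] by (subst finsum_Suc) (simp_all add: F Pi_def)
  finally show ?case by (simp only: Rr)
qed

theorem skew_UP_ring:
  assumes s: "\<sigma> \<in> ring_hom R R"
  shows "ring (skew_UP R \<sigma>)"
proof -
  interpret P: UP_ring R "UP R" by unfold_locales simp_all
  note hom = endo_funpow[OF s]
  note cl = ring_hom_closed[OF hom]
  note S = skew_UP_simps
  note mc = up_skew_mult_closed[OF s]
  have add: "add (skew_UP R \<sigma>) = add (UP R)" and z: "zero (skew_UP R \<sigma>) = zero (UP R)"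
    and c: "carrier (skew_UP R \<sigma>) = carrier (UP R)"
    by (simp_all add: skew_UP_def)
  have one: "(\<lambda>i. if i = 0 then \<one> else \<zero>) \<in> up R" by (rule up_one_closed)
  show ?thesis
  proof (rule ringI)
    show "abelian_group (skew_UP R \<sigma>)"
      by (auto intro!: abelian_groupI P.UP_a_assoc P.UP_a_comm P.UP_l_neg_ex simp: add z c)
  next
    show "monoid (skew_UP R \<sigma>)"
    proof (rule monoidI)
      fix p q r
      assume "p \<in> carrier (skew_UP R \<sigma>)" "q \<in> carrier (skew_UP R \<sigma>)" "r \<in> carrier (skew_UP R \<sigma>)"
      then have p: "p \<in> up R" and q: "q \<in> up R" and r: "r \<in> up R" by (simp_all add: S)
      have "(\<sigma> ^^ j) (\<Oplus>i \<in> {..m}. q i \<otimes> (\<sigma> ^^ i) (r (m - i)))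
          = (\<Oplus>i \<in> {..m}. (\<sigma> ^^ j) (q i \<otimes> (\<sigma> ^^ i) (r (m - i))))" for j m
        by (intro endo_finsum[OF hom] m_closed cl mem_upD[OF q] mem_upD[OF r] finite_atMost)
      then show "p \<otimes>\<^bsub>skew_UP R \<sigma>\<^esub> q \<otimes>\<^bsub>skew_UP R \<sigma>\<^esub> r = p \<otimes>\<^bsub>skew_UP R \<sigma>\<^esub> (q \<otimes>\<^bsub>skew_UP R \<sigma>\<^esub> r)"
        using skew_assoc_aux[OF s, of p q r, OF mem_upD[OF p] mem_upD[OF q] mem_upD[OF r] le_refl]
        by (simp add: S p q r mc del: diff_diff_left)
    next
      fix p assume "p \<in> carrier (skew_UP R \<sigma>)"
      then have p: "p \<in> up R" by (simp add: S)
      show "\<one>\<^bsub>skew_UP R \<sigma>\<^esub> \<otimes>\<^bsub>skew_UP R \<sigma>\<^esub> p = p"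
      proof -
        have "(\<Oplus>i \<in> {..n}. (if i = 0 then \<one> else \<zero>) \<otimes> (\<sigma> ^^ i) (p (n - i))) = p n" for n
        proof -
          have "(\<Oplus>i \<in> {..n}. (if i = 0 then \<one> else \<zero>) \<otimes> (\<sigma> ^^ i) (p (n - i)))
              = (\<Oplus>i \<in> {..n}. if 0 = i then p (n - i) else \<zero>)"
            by (rule finsum_cong') (auto simp: cl mem_upD[OF p])
          also have "\<dots> = p n"
            using finsum_singleton[of 0 "{..n}" "\<lambda>i. p (n - i)"] mem_upD[OF p] by auto
          finally show ?thesis .
        qed
        then show ?thesis using p one by (simp add: S)
      qed
      show "p \<otimes>\<^bsub>skew_UP R \<sigma>\<^esub> \<one>\<^bsub>skew_UP R \<sigma>\<^esub> = p"
      proof -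
        have "(\<Oplus>i \<in> {..n}. p i \<otimes> (\<sigma> ^^ i) (if n - i = 0 then \<one> else \<zero>)) = p n" for n
        proof -
          have "(\<Oplus>i \<in> {..n}. p i \<otimes> (\<sigma> ^^ i) (if n - i = 0 then \<one> else \<zero>))
              = (\<Oplus>i \<in> {..n}. if n = i then p i else \<zero>)"
            by (rule finsum_cong')
              (auto simp: mem_upD[OF p] ring_hom_one[OF hom]
                ring_hom_zero[OF hom ring_axioms ring_axioms])
          also have "\<dots> = p n"
            using finsum_singleton[of n "{..n}" p] mem_upD[OF p] by auto
          finally show ?thesis .
        qed
        then show ?thesis using p one by (simp add: S)
      qed
    qed (simp_all add: S mc one)
  next
    fix p q r
    assume "p \<in> carrier (skew_UP R \<sigma>)" "q \<in> carrier (skew_UP R \<sigma>)" "r \<in> carrier (skew_UP R \<sigma>)"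
    then have p: "p \<in> up R" and q: "q \<in> up R" and r: "r \<in> up R" by (simp_all add: S)
    have "(\<Oplus>i \<in> {..n}. (p i \<oplus> q i) \<otimes> (\<sigma> ^^ i) (r (n - i)))
        = (\<Oplus>i \<in> {..n}. p i \<otimes> (\<sigma> ^^ i) (r (n - i))) \<oplus> (\<Oplus>i \<in> {..n}. q i \<otimes> (\<sigma> ^^ i) (r (n - i)))" for n
      by (subst finsum_addf[symmetric])
        (auto intro!: finsum_cong' simp: l_distr cl mem_upD[OF p] mem_upD[OF q] mem_upD[OF r])
    then show "(p \<oplus>\<^bsub>skew_UP R \<sigma>\<^esub> q) \<otimes>\<^bsub>skew_UP R \<sigma>\<^esub> r
        = p \<otimes>\<^bsub>skew_UP R \<sigma>\<^esub> r \<oplus>\<^bsub>skew_UP R \<sigma>\<^esub> q \<otimes>\<^bsub>skew_UP R \<sigma>\<^esub> r"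
      by (simp add: S p q r mc up_add_closed)
    have "(\<Oplus>i \<in> {..n}. r i \<otimes> (\<sigma> ^^ i) (p (n - i) \<oplus> q (n - i)))
        = (\<Oplus>i \<in> {..n}. r i \<otimes> (\<sigma> ^^ i) (p (n - i))) \<oplus> (\<Oplus>i \<in> {..n}. r i \<otimes> (\<sigma> ^^ i) (q (n - i)))" for n
      by (subst finsum_addf[symmetric])
        (auto intro!: finsum_cong' simp: r_distr cl ring_hom_add[OF hom]
          mem_upD[OF p] mem_upD[OF q] mem_upD[OF r])
    then show "r \<otimes>\<^bsub>skew_UP R \<sigma>\<^esub> (p \<oplus>\<^bsub>skew_UP R \<sigma>\<^esub> q)
        = r \<otimes>\<^bsub>skew_UP R \<sigma>\<^esub> p \<oplus>\<^bsub>skew_UP R \<sigma>\<^esub> r \<otimes>\<^bsub>skew_UP R \<sigma>\<^esub> q"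
      by (simp add: S p q r mc up_add_closed)
  qed
qed

lemma skew_UP_monom_mult:
  assumes s: "\<sigma> \<in> ring_hom R R" and a: "a \<in> carrier R" and b: "b \<in> carrier R"
  shows "monom (skew_UP R \<sigma>) a m \<otimes>\<^bsub>skew_UP R \<sigma>\<^esub> monom (skew_UP R \<sigma>) b n
    = monom (skew_UP R \<sigma>) (a \<otimes> (\<sigma> ^^ m) b) (m + n)"
proof -
  note hom = endo_funpow[OF s]
  note cl = ring_hom_closed[OF hom]
  have "(\<Oplus>i \<in> {..k}. (if i = m then a else \<zero>) \<otimes> (\<sigma> ^^ i) (if k - i = n then b else \<zero>))
      = (if k = m + n then a \<otimes> (\<sigma> ^^ m) b else \<zero>)" for k
  proof -
    have "(\<Oplus>i \<in> {..k}. (if i = m then a else \<zero>) \<otimes> (\<sigma> ^^ i) (if k - i = n then b else \<zero>))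
        = (\<Oplus>i \<in> {..k}. if m = i then (if k = m + n then a \<otimes> (\<sigma> ^^ m) b else \<zero>) else \<zero>)"
      by (rule finsum_cong')
        (use a b cl ring_hom_zero[OF hom ring_axioms ring_axioms] in auto)
    also have "\<dots> = (if k = m + n then a \<otimes> (\<sigma> ^^ m) b else \<zero>)"
    proof (cases "m \<le> k")
      case True
      then show ?thesis
        using finsum_singleton[of m "{..k}" "\<lambda>i. if k = m + n then a \<otimes> (\<sigma> ^^ m) b else \<zero>"] a b cl
        by auto
    next
      case False
      then have "(\<Oplus>i \<in> {..k}. if m = i then (if k = m + n then a \<otimes> (\<sigma> ^^ m) b else \<zero>) else \<zero>)
          = (\<Oplus>i \<in> {..k}. \<zero>)"
        by (intro finsum_cong') auto
      with False show ?thesis by simp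
    qed
    finally show ?thesis .
  qed
  then show ?thesis using a b cl by (simp add: skew_UP_simps up_monom_closed)
qed

corollary skew_UP_X_mult:
  assumes "\<sigma> \<in> ring_hom R R" and "a \<in> carrier R"
  shows "monom (skew_UP R \<sigma>) \<one> 1 \<otimes>\<^bsub>skew_UP R \<sigma>\<^esub> monom (skew_UP R \<sigma>) a 0
    = monom (skew_UP R \<sigma>) (\<sigma> a) 0 \<otimes>\<^bsub>skew_UP R \<sigma>\<^esub> monom (skew_UP R \<sigma>) \<one> 1"
  using assms by (simp add: skew_UP_monom_mult ring_hom_closed)

end

end

theory Submission
  imports Defs
begin

text \<open>
  Let \<open>f = \<Sum> a\<^sub>i x\<^sup>i\<close> have a nonzero right annihilator and let \<open>g = \<Sum> b\<^sub>j x\<^sup>j\<close> be a nonzero one of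
  least degree \<open>m\<close>. By semicommutativity \<open>a\<^sub>k x\<^sup>k g = (\<Sum> a\<^sub>k \<sigma>\<^sup>k(b\<^sub>j) x\<^sup>j) x\<^sup>k\<close> annihilates \<open>f\<close> as
  well, and right multiplication by \<open>x\<^sup>k\<close> is injective, so \<open>h = \<Sum> a\<^sub>k \<sigma>\<^sup>k(b\<^sub>j) x\<^sup>j\<close> annihilates
  \<open>f\<close>. If \<open>a\<^sub>i x\<^sup>i g = 0\<close> for all \<open>i > k\<close>, then comparing coefficients of \<open>x\<^sup>k\<^sup>+\<^sup>m\<close> in \<open>f g = 0\<close>
  gives \<open>a\<^sub>k \<sigma>\<^sup>k(b\<^sub>m) = 0\<close>; so \<open>h\<close> has degree below \<open>m\<close> and vanishes. By descending induction
  on \<open>k\<close>, \<open>a\<^sub>k \<sigma>\<^sup>k(b\<^sub>m) = 0\<close> for all \<open>k\<close>, that is, \<open>f b\<^sub>m = 0\<close>.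
\<close>

context ring
begin

lemma up_skew_scale_closed:
  assumes s: "\<sigma> \<in> ring_hom R R" and a: "a \<in> carrier R" and q: "q \<in> up R"
  shows "(\<lambda>j. a \<otimes> (\<sigma> ^^ k) (q j)) \<in> up R"
proof
  note hom = endo_funpow[OF s]
  show "a \<otimes> (\<sigma> ^^ k) (q j) \<in> carrier R" for j
    by (intro m_closed a ring_hom_closed[OF hom] mem_upD[OF q])
  from q obtain m where "bound \<zero> m q" by fast
  then have "bound \<zero> m (\<lambda>j. a \<otimes> (\<sigma> ^^ k) (q j))"
    using a by (auto simp: bound_def ring_hom_zero[OF hom ring_axioms ring_axioms])
  then show "\<exists>m. bound \<zero> m (\<lambda>j. a \<otimes> (\<sigma> ^^ k) (q j))" by blast
qed

lemma skew_UP_monom_mult_coeff: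
  assumes s: "\<sigma> \<in> ring_hom R R" and a: "a \<in> carrier R" and q: "q \<in> up R"
  shows "(monom (skew_UP R \<sigma>) a k \<otimes>\<^bsub>skew_UP R \<sigma>\<^esub> q) n =
    (if k \<le> n then a \<otimes> (\<sigma> ^^ k) (q (n - k)) else \<zero>)"
proof -
  note cl = ring_hom_closed[OF endo_funpow[OF s] mem_upD[OF q]]
  have "(monom (skew_UP R \<sigma>) a k \<otimes>\<^bsub>skew_UP R \<sigma>\<^esub> q) n
      = (\<Oplus>i \<in> {..n}. (if i = k then a else \<zero>) \<otimes> (\<sigma> ^^ i) (q (n - i)))"
    using a q by (simp add: skew_UP_simps up_monom_closed)
  also have "\<dots> = (\<Oplus>i \<in> {..n}. if k = i then a \<otimes> (\<sigma> ^^ i) (q (n - i)) else \<zero>)"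
    by (rule finsum_cong') (use a cl in auto)
  also have "\<dots> = (if k \<le> n then a \<otimes> (\<sigma> ^^ k) (q (n - k)) else \<zero>)"
  proof (cases "k \<le> n")
    case True
    then show ?thesis
      using finsum_singleton[of k "{..n}" "\<lambda>i. a \<otimes> (\<sigma> ^^ i) (q (n - i))"] a cl by auto
  next
    case False
    then have "(\<Oplus>i \<in> {..n}. if k = i then a \<otimes> (\<sigma> ^^ i) (q (n - i)) else \<zero>) = (\<Oplus>i \<in> {..n}. \<zero>)"
      by (intro finsum_cong') auto
    with False show ?thesis by simp
  qed
  finally show ?thesis .
qed

text \<open>Since \<open>(\<sigma> ^^ i) \<zero> = \<zero>\<close>, only the term
  \<open>i = n - k\<close> of the convolution sum survives.\<close>

lemma skew_UP_mult_monom_coeff: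
  assumes s: "\<sigma> \<in> ring_hom R R" and p: "p \<in> up R" and c: "c \<in> carrier R"
  shows "(p \<otimes>\<^bsub>skew_UP R \<sigma>\<^esub> monom (skew_UP R \<sigma>) c k) n =
    (if k \<le> n then p (n - k) \<otimes> (\<sigma> ^^ (n - k)) c else \<zero>)"
proof -
  note hom = endo_funpow[OF s]
  note cl = ring_hom_closed[OF hom]
  have "(p \<otimes>\<^bsub>skew_UP R \<sigma>\<^esub> monom (skew_UP R \<sigma>) c k) n
      = (\<Oplus>i \<in> {..n}. p i \<otimes> (\<sigma> ^^ i) (if n - i = k then c else \<zero>))"
    using c p by (simp add: skew_UP_simps up_monom_closed)
  also have "\<dots> = (if k \<le> n then p (n - k) \<otimes> (\<sigma> ^^ (n - k)) c else \<zero>)"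
  proof (cases "k \<le> n")
    case True
    then have "(\<Oplus>i \<in> {..n}. p i \<otimes> (\<sigma> ^^ i) (if n - i = k then c else \<zero>))
        = (\<Oplus>i \<in> {..n}. if n - k = i then p i \<otimes> (\<sigma> ^^ i) c else \<zero>)"
      by (intro finsum_cong')
        (use c cl mem_upD[OF p] ring_hom_zero[OF hom ring_axioms ring_axioms] in auto)
    also have "\<dots> = p (n - k) \<otimes> (\<sigma> ^^ (n - k)) c"
      using finsum_singleton[of "n - k" "{..n}" "\<lambda>i. p i \<otimes> (\<sigma> ^^ i) c"] c cl mem_upD[OF p]
      by auto
    finally show ?thesis using True by simp
  next
    case False
    then have "(\<Oplus>i \<in> {..n}. p i \<otimes> (\<sigma> ^^ i) (if n - i = k then c else \<zero>)) = (\<Oplus>i \<in> {..n}. \<zero>)"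
      by (intro finsum_cong')
        (use c mem_upD[OF p] ring_hom_zero[OF hom ring_axioms ring_axioms] in auto)
    with False show ?thesis by simp
  qed
  finally show ?thesis .
qed

text \<open>Powers of \<open>\<sigma>\<close> fix \<open>\<one>\<close>, so right multiplication by
  \<open>x^k\<close> merely shifts coefficients: \<open>p n\<close> reappears unchanged at index
  \<open>n + k\<close>.\<close>

lemma skew_UP_mult_X_pow_eq_zero:
  assumes s: "\<sigma> \<in> ring_hom R R" and p: "p \<in> up R"
    and z: "p \<otimes>\<^bsub>skew_UP R \<sigma>\<^esub> monom (skew_UP R \<sigma>) \<one> k = \<zero>\<^bsub>skew_UP R \<sigma>\<^esub>"
  shows "p = \<zero>\<^bsub>skew_UP R \<sigma>\<^esub>"
proof -
  have "p n = \<zero>" for n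
    using skew_UP_mult_monom_coeff[OF s p one_closed, of k "n + k"]
    by (simp add: z skew_UP_simps(2) ring_hom_one[OF endo_funpow[OF s]] mem_upD[OF p])
  then show ?thesis by (auto simp: skew_UP_simps)
qed

text \<open>Carrying \<open>x^k\<close> to the right past \<open>q\<close> applies
  \<open>\<sigma> ^^ k\<close> to every coefficient; on the right it can be cancelled.\<close>

lemma skew_UP_monom_mult_eq:
  assumes s: "\<sigma> \<in> ring_hom R R" and a: "a \<in> carrier R" and q: "q \<in> up R"
  shows "monom (skew_UP R \<sigma>) a k \<otimes>\<^bsub>skew_UP R \<sigma>\<^esub> q
    = (\<lambda>j. a \<otimes> (\<sigma> ^^ k) (q j)) \<otimes>\<^bsub>skew_UP R \<sigma>\<^esub> monom (skew_UP R \<sigma>) \<one> k"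
proof
  fix n
  show "(monom (skew_UP R \<sigma>) a k \<otimes>\<^bsub>skew_UP R \<sigma>\<^esub> q) n
    = ((\<lambda>j. a \<otimes> (\<sigma> ^^ k) (q j)) \<otimes>\<^bsub>skew_UP R \<sigma>\<^esub> monom (skew_UP R \<sigma>) \<one> k) n"
    unfolding skew_UP_monom_mult_coeff[OF s a q]
      skew_UP_mult_monom_coeff[OF s up_skew_scale_closed[OF s a q] one_closed]
    using a q by (simp add: ring_hom_one[OF endo_funpow[OF s]]
        ring_hom_closed[OF endo_funpow[OF s]] mem_upD)
qed

text \<open>Semicommutativity inserts \<open>a x^k\<close> between \<open>p\<close> and
  \<open>q\<close>. Cancelling \<open>x^k\<close> on the right then undoes the rise in degree, so
  that the new annihilator can be compared with one of least degree.\<close>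

lemma semicommutative_skew_scale_annihilates:
  assumes s: "\<sigma> \<in> ring_hom R R" and sc: "semicommutative (skew_UP R \<sigma>)"
    and a: "a \<in> carrier R" and p: "p \<in> up R" and q: "q \<in> up R"
    and pq: "p \<otimes>\<^bsub>skew_UP R \<sigma>\<^esub> q = \<zero>\<^bsub>skew_UP R \<sigma>\<^esub>"
  shows "p \<otimes>\<^bsub>skew_UP R \<sigma>\<^esub> (\<lambda>j. a \<otimes> (\<sigma> ^^ k) (q j)) = \<zero>\<^bsub>skew_UP R \<sigma>\<^esub>"
proof -
  interpret S: ring "skew_UP R \<sigma>" by (rule skew_UP_ring[OF s])
  let ?h = "\<lambda>j. a \<otimes> (\<sigma> ^^ k) (q j)"
  have car: "p \<in> carrier (skew_UP R \<sigma>)" "q \<in> carrier (skew_UP R \<sigma>)"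
    "?h \<in> carrier (skew_UP R \<sigma>)" "monom (skew_UP R \<sigma>) a k \<in> carrier (skew_UP R \<sigma>)"
    "monom (skew_UP R \<sigma>) \<one> k \<in> carrier (skew_UP R \<sigma>)"
    using p q a up_skew_scale_closed[OF s a q] by (simp_all add: skew_UP_simps up_monom_closed)
  have "p \<otimes>\<^bsub>skew_UP R \<sigma>\<^esub> monom (skew_UP R \<sigma>) a k \<otimes>\<^bsub>skew_UP R \<sigma>\<^esub> q = \<zero>\<^bsub>skew_UP R \<sigma>\<^esub>"
    using sc pq car unfolding semicommutative_def by blast
  then have "p \<otimes>\<^bsub>skew_UP R \<sigma>\<^esub> ?h \<otimes>\<^bsub>skew_UP R \<sigma>\<^esub> monom (skew_UP R \<sigma>) \<one> k = \<zero>\<^bsub>skew_UP R \<sigma>\<^esub>"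
    using car by (simp add: S.m_assoc skew_UP_monom_mult_eq[OF s a q])
  moreover have "p \<otimes>\<^bsub>skew_UP R \<sigma>\<^esub> ?h \<in> up R"
    using S.m_closed[OF car(1) car(3)] by (simp add: skew_UP_simps)
  ultimately show ?thesis by (rule skew_UP_mult_X_pow_eq_zero[OF s, rotated])
qed

text \<open>In \<open>minimal\<close>, degree below \<open>m\<close> is written as
  \<open>bound \<zero> m h\<close> with \<open>h m = \<zero>\<close>, which also makes sense for
  \<open>m = 0\<close>. The claim covers all \<open>j\<close>, not only \<open>j = m\<close>,
  because the induction needs every product with a higher index \<open>k\<close> to vanish.\<close>

lemma skew_UP_minimal_annihilator:
  assumes s: "\<sigma> \<in> ring_hom R R" and sc: "semicommutative (skew_UP R \<sigma>)"
    and p: "p \<in> up R" and q: "q \<in> up R" and m: "bound \<zero> m q"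
    and pq: "p \<otimes>\<^bsub>skew_UP R \<sigma>\<^esub> q = \<zero>\<^bsub>skew_UP R \<sigma>\<^esub>"
    and minimal: "\<And>h. h \<in> up R \<Longrightarrow> p \<otimes>\<^bsub>skew_UP R \<sigma>\<^esub> h = \<zero>\<^bsub>skew_UP R \<sigma>\<^esub> \<Longrightarrow>
      bound \<zero> m h \<Longrightarrow> h m = \<zero> \<Longrightarrow> h = \<zero>\<^bsub>skew_UP R \<sigma>\<^esub>"
  shows "p k \<otimes> (\<sigma> ^^ k) (q j) = \<zero>"
proof -
  note hom = endo_funpow[OF s]
  note hz = ring_hom_zero[OF hom ring_axioms ring_axioms]
  note cl = ring_hom_closed[OF hom mem_upD[OF q]]
  from p obtain n where n: "bound \<zero> n p" by fast
  have "\<forall>j. p k \<otimes> (\<sigma> ^^ k) (q j) = \<zero>"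
  \<comment> \<open>Descending induction on \<open>k\<close>: the measure drops from
    \<open>k\<close> to \<open>i\<close> when \<open>k < i \<le> n\<close>, and for
    \<open>i > n\<close> the coefficient \<open>p i\<close> is zero.\<close>
  proof (induction "n - k" arbitrary: k rule: less_induct)
    case less
    have above: "p i \<otimes> (\<sigma> ^^ i) (q j) = \<zero>" if "k < i" for i j
    proof (cases "i \<le> n")
      case True
      with that less show ?thesis by simp
    next
      case False
      then have "p i = \<zero>" using n by (auto simp: bound_def)
      then show ?thesis by (simp add: cl)
    qed
    \<comment> \<open>At index \<open>k + m\<close>, terms with \<open>i < k\<close> involve
      \<open>q\<close> beyond its bound \<open>m\<close>, and terms with \<open>i > k\<close> vanish
      by \<open>above\<close>; only \<open>i = k\<close> is left.\<close>
    have "\<zero> = (p \<otimes>\<^bsub>skew_UP R \<sigma>\<^esub> q) (k + m)" by (simp add: pq skew_UP_simps)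
    also have "\<dots> = (\<Oplus>i \<in> {..k + m}. p i \<otimes> (\<sigma> ^^ i) (q (k + m - i)))"
      using p q by (simp add: skew_UP_simps)
    also have "\<dots> = (\<Oplus>i \<in> {..k + m}. if k = i then p i \<otimes> (\<sigma> ^^ i) (q (k + m - i)) else \<zero>)"
    proof (rule finsum_cong')
      fix i assume "i \<in> {..k + m}"
      show "p i \<otimes> (\<sigma> ^^ i) (q (k + m - i))
        = (if k = i then p i \<otimes> (\<sigma> ^^ i) (q (k + m - i)) else \<zero>)"
      proof (cases i k rule: linorder_cases)
        case less
        then have "q (k + m - i) = \<zero>" using m by (auto simp: bound_def)
        with less show ?thesis by (simp add: hz mem_upD[OF p])
      qed (simp_all add: above)
    qed (use cl mem_upD[OF p] in auto)
    also have "\<dots> = p k \<otimes> (\<sigma> ^^ k) (q m)"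
      using finsum_singleton[of k "{..k + m}" "\<lambda>i. p i \<otimes> (\<sigma> ^^ i) (q (k + m - i))"]
        cl mem_upD[OF p] by auto
    finally have top: "p k \<otimes> (\<sigma> ^^ k) (q m) = \<zero>" by simp
    have "(\<lambda>j. p k \<otimes> (\<sigma> ^^ k) (q j)) = \<zero>\<^bsub>skew_UP R \<sigma>\<^esub>"
    proof (rule minimal)
      show "(\<lambda>j. p k \<otimes> (\<sigma> ^^ k) (q j)) \<in> up R"
        by (rule up_skew_scale_closed[OF s mem_upD[OF p] q])
      show "p \<otimes>\<^bsub>skew_UP R \<sigma>\<^esub> (\<lambda>j. p k \<otimes> (\<sigma> ^^ k) (q j)) = \<zero>\<^bsub>skew_UP R \<sigma>\<^esub>"
        by (rule semicommutative_skew_scale_annihilates[OF s sc mem_upD[OF p] p q pq])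
      show "bound \<zero> m (\<lambda>j. p k \<otimes> (\<sigma> ^^ k) (q j))"
        using m by (auto simp: bound_def hz mem_upD[OF p])
    qed (rule top)
    then show ?case by (simp add: skew_UP_simps fun_eq_iff)
  qed
  then show ?thesis by blast
qed

end

theorem proposition2p6:
  fixes R (structure) and \<sigma>
  assumes "ring R"
    and "\<sigma> \<in> ring_hom R R"
    and "semicommutative (skew_UP R \<sigma>)"
  shows "skew_McCoy R \<sigma>"
  unfolding skew_McCoy_def
proof (intro ballI impI)
  interpret ring R by fact
  fix p q
  assume "p \<in> carrier (skew_UP R \<sigma>)" "q \<in> carrier (skew_UP R \<sigma>)"
    and q0: "q \<noteq> \<zero>\<^bsub>skew_UP R \<sigma>\<^esub>" and pq: "p \<otimes>\<^bsub>skew_UP R \<sigma>\<^esub> q = \<zero>\<^bsub>skew_UP R \<sigma>\<^esub>"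
  then have p: "p \<in> up R" and q: "q \<in> up R" by (simp_all add: skew_UP_simps)
  define P where "P m \<longleftrightarrow> (\<exists>g \<in> up R. g \<noteq> \<zero>\<^bsub>skew_UP R \<sigma>\<^esub> \<and>
    p \<otimes>\<^bsub>skew_UP R \<sigma>\<^esub> g = \<zero>\<^bsub>skew_UP R \<sigma>\<^esub> \<and> bound \<zero> m g)" for m
  define m where "m = (LEAST m. P m)"
  from q obtain d where "bound \<zero> d q" by fast
  with q q0 pq have "P d" unfolding P_def by blast
  then have "P m" unfolding m_def by (rule LeastI)
  then obtain g where g: "g \<in> up R" "g \<noteq> \<zero>\<^bsub>skew_UP R \<sigma>\<^esub>"
    "p \<otimes>\<^bsub>skew_UP R \<sigma>\<^esub> g = \<zero>\<^bsub>skew_UP R \<sigma>\<^esub>" "bound \<zero> m g"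
    unfolding P_def by blast
  have minimal: "h = \<zero>\<^bsub>skew_UP R \<sigma>\<^esub>"
    if h: "h \<in> up R" "p \<otimes>\<^bsub>skew_UP R \<sigma>\<^esub> h = \<zero>\<^bsub>skew_UP R \<sigma>\<^esub>" "bound \<zero> m h" "h m = \<zero>" for h
  \<comment> \<open>For \<open>m = 0\<close> no coefficient of \<open>h\<close> is left; otherwise
    \<open>h m = \<zero>\<close> sharpens the bound to \<open>m - 1\<close>, against the choice of
    \<open>m\<close>.\<close>
  proof (cases m)
    case 0
    then have "h j = \<zero>" for j using h(3,4) by (cases "j = 0") auto
    then show ?thesis by (auto simp: skew_UP_simps)
  next
    case (Suc l)
    have "bound \<zero> l h"
    proof
      fix j assume "l < j"
      then show "h j = \<zero>" using h(3,4) Suc by (cases "j = m") (auto simp: bound_def)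
    qed
    moreover have "\<not> P l" using not_less_Least[of l P] Suc by (simp add: m_def)
    ultimately show ?thesis using h unfolding P_def by blast
  qed
  \<comment> \<open>If \<open>g m\<close> were zero, \<open>minimal\<close> would apply to
    \<open>g\<close> itself.\<close>
  have gm: "g m \<noteq> \<zero>" using minimal[OF g(1,3,4)] g(2) by blast
  have gc: "g m \<in> carrier R" by (rule mem_upD[OF g(1)])
  have "p k \<otimes> (\<sigma> ^^ k) (g m) = \<zero>" for k
    by (rule skew_UP_minimal_annihilator[OF assms(2,3) p g(1,4,3) minimal])
  \<comment> \<open>For a constant \<open>c\<close>, coefficient \<open>k\<close> of the product is
    \<open>p k \<otimes> (\<sigma> ^^ k) c\<close>; the witness is the leading coefficient
    \<open>g m\<close>.\<close>
  then have "p \<otimes>\<^bsub>skew_UP R \<sigma>\<^esub> monom (skew_UP R \<sigma>) (g m) 0 = \<zero>\<^bsub>skew_UP R \<sigma>\<^esub>"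
    by (auto simp: skew_UP_mult_monom_coeff[OF assms(2) p gc] skew_UP_simps(2))
  with gm gc show "\<exists>c \<in> carrier R. c \<noteq> \<zero> \<and>
      p \<otimes>\<^bsub>skew_UP R \<sigma>\<^esub> monom (skew_UP R \<sigma>) c 0 = \<zero>\<^bsub>skew_UP R \<sigma>\<^esub>" by blast
qed

end
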